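(* Let $\mathcal{A}$ be a $2\times 2$ sign pattern. (a) If $\mathcal{A}$ is irreducible, then $\mathcal{A}$ requires the nSMP. (b) If $\mathcal{A}$ is equivalent to a reducible pattern and the two diagonal entries of $\mathcal{A}$ are two distinct symbols from $\{0,+,-\}$, then $\mathcal{A}$ requires the nSMP. (c) If $\mathcal{A}$ is reducible and its two diagonal entries are both zero, then $\mathcal{A}$ does not allow the nSMP. (d) If $\mathcal{A}$ is reducible and its two diagonal entries are equal and nonzero, then $\mathcal{A}$ allows the nSMP but does not require the nSMP.
   Context: A real $n\times n$ matrix $A$ has the non-symmetric strong multiplicity property (nSMP) if the only real $n\times n$ matrix $X$ satisfying all of (1) $A\circ X=O$ (entrywise product), (2) $AX^T-X^TA=O$, and (3) $\mathrm{tr}(X^TA^k)=0$ for all $0\le k<n$, is $X=O$ (the zero matrix). A sign pattern is an $n\times n$ matrix $\mathcal{A}$ with entries in $\{+,-,0\}$; $Q(\mathcal{A})$ is the set of real $n\times n$ matrices $A$ with $A_{ij}>0$ if $\mathcal{A}_{ij}=+$, $A_{ij}<0$ if $\mathcal{A}_{ij}=-$, and $A_{ij}=0$ if $\mathcal{A}_{ij}=0$. The pattern $\mathcal{A}$ allows a property if some $A\in Q(\mathcal{A})$ has it, and requires a property if every $A\in Q(\mathcal{A})$ has it. A matrix or pattern is reducible if it is permutationally similar to a block upper triangular matrix with two square (nonempty) diagonal blocks, and irreducible otherwise; so a $2\times 2$ pattern is irreducible exactly when both off-diagonal entries are nonzero. Two sign patterns are equivalent if one can be obtained from the other by permutation similarity,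 signature similarity (conjugation by a diagonal matrix with diagonal entries $\pm1$), transposition, and/or negation. *)

theory Defs
  imports "HOL-Analysis.Analysis"
begin

(* The HOL-Analysis type vec carries the componentwise ring operations, so on
   matrices * is the entrywise (Hadamard) product and ^ the entrywise power;
   the matrix product is **. *)

definition mat_power :: "real^'n^'n \<Rightarrow> nat \<Rightarrow> real^'n^'n" where
  "mat_power A k = (((**) A) ^^ k) (mat 1)"

definition nSMP :: "real^'n^'n \<Rightarrow> bool" where
  "nSMP A \<longleftrightarrow>
     (\<forall>X :: real^'n^'n.
        A * X = 0 \<and>
        A ** transpose X - transpose X ** A = 0 \<and>
        (\<forall>k < CARD('n). trace (transpose X ** mat_power A k) = 0)
        \<longrightarrow> X = 0)"

datatype sign = Pos | Neg | Zero

instantiation sign :: "{zero, uminus, times}"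
begin

definition zero_sign :: sign where
  "0 = Zero"

definition uminus_sign :: "sign \<Rightarrow> sign" where
  "- s = (case s of Pos \<Rightarrow> Neg | Neg \<Rightarrow> Pos | Zero \<Rightarrow> Zero)"

definition times_sign :: "sign \<Rightarrow> sign \<Rightarrow> sign" where
  "s * t = (case s of Pos \<Rightarrow> t | Neg \<Rightarrow> - t | Zero \<Rightarrow> Zero)"

instance ..

end

definition qual_class :: "sign^'n^'n \<Rightarrow> (real^'n^'n) set" where
  "qual_class P = {A. \<forall>i j.
     (P $ i $ j = Pos \<longrightarrow> A $ i $ j > 0) \<and>
     (P $ i $ j = Neg \<longrightarrow> A $ i $ j < 0) \<and>
     (P $ i $ j = Zero \<longrightarrow> A $ i $ j = 0)}"

definition pattern_allows :: "sign^'n^'n \<Rightarrow> (real^'n^'n \<Rightarrow> bool) \<Rightarrow> bool" where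
  "pattern_allows P \<phi> \<longleftrightarrow> (\<exists>A \<in> qual_class P. \<phi> A)"

definition pattern_requires :: "sign^'n^'n \<Rightarrow> (real^'n^'n \<Rightarrow> bool) \<Rightarrow> bool" where
  "pattern_requires P \<phi> \<longleftrightarrow> (\<forall>A \<in> qual_class P. \<phi> A)"

definition perm_similar :: "'a^'n^'n \<Rightarrow> 'a^'n^'n \<Rightarrow> bool" where
  "perm_similar P R \<longleftrightarrow>
     (\<exists>\<pi>. \<pi> permutes (UNIV :: 'n set) \<and> R = (\<chi> i j. P $ \<pi> i $ \<pi> j))"

definition signature_similar :: "sign^'n^'n \<Rightarrow> sign^'n^'n \<Rightarrow> bool" where
  "signature_similar P R \<longleftrightarrow>
     (\<exists>d :: 'n \<Rightarrow> sign. (\<forall>i. d i \<in> {Pos, Neg}) \<and>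
        R = (\<chi> i j. d i * P $ i $ j * d j))"

definition elem_equiv :: "sign^'n^'n \<Rightarrow> sign^'n^'n \<Rightarrow> bool" where
  "elem_equiv P R \<longleftrightarrow>
     perm_similar P R \<or> signature_similar P R \<or> R = transpose P \<or> R = - P"

(* Each elementary operation is reversible by one of the same kind, so the
   reflexive transitive closure is already symmetric. *)
definition pattern_equiv :: "sign^'n^'n \<Rightarrow> sign^'n^'n \<Rightarrow> bool" where
  "pattern_equiv = elem_equiv\<^sup>*\<^sup>*"

(* The diagonal blocks are indexed by {..<b} and {b..}.  The index order is that
   of the type 'n; in the type 2 the numeral 2 equals 0, so row 2 precedes row 1
   there.  This does not affect reducible_pattern, which is invariant under
   permutation similarity. *)
definition block_upper_triangular :: "('a::zero)^('n::{finite,linorder})^('n::{finite,linorder}) \<Rightarrow> bool" where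
  "block_upper_triangular P \<longleftrightarrow>
     (\<exists>b. {..<b} \<noteq> {} \<and> {b..} \<noteq> {} \<and> (\<forall>i\<in>{b..}. \<forall>j\<in>{..<b}. P $ i $ j = 0))"

definition reducible_pattern :: "sign^('n::{finite,linorder})^('n::{finite,linorder}) \<Rightarrow> bool" where
  "reducible_pattern P \<longleftrightarrow> (\<exists>R. perm_similar P R \<and> block_upper_triangular R)"

abbreviation irreducible_pattern :: "sign^('n::{finite,linorder})^('n::{finite,linorder}) \<Rightarrow> bool" where
  "irreducible_pattern P \<equiv> \<not> reducible_pattern P"

end

theory Submission
  imports Defs
begin

text \<open>For a real 2-by-2 matrix A and X with rows (x, y) and (z, w), the trace condition for k = 0
  gives w = -x, the one for k = 1 then follows from the entrywise condition, and the commutation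
  condition becomes z (a - d) = 2 b x and y (a - d) = 2 c x, where a, d and b, c are the
  diagonal and off-diagonal entries of A. Hence A has the nSMP iff a and d differ or b and c are
  both nonzero; in the remaining case an off-diagonal matrix unit is a nonzero solution X.\<close>

lemma nSMP_2_iff:
  fixes A :: "real^2^2"
  shows "nSMP A \<longleftrightarrow> A $ 1 $ 1 \<noteq> A $ 2 $ 2 \<or> (A $ 1 $ 2 \<noteq> 0 \<and> A $ 2 $ 1 \<noteq> 0)"
    (is "_ \<longleftrightarrow> ?R")
proof -
  have all_less_2: "(\<forall>k < 2. Q k) \<longleftrightarrow> Q 0 \<and> Q 1" for Q :: "nat \<Rightarrow> bool"
    by (auto simp: less_2_cases_iff)
  note entries = all_less_2 mat_power_def trace_def vec_eq_iff forall_2 sum_2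
    matrix_matrix_mult_def transpose_def mat_def
  show ?thesis
  proof
    assume ?R
    show "nSMP A"
      unfolding nSMP_def
    proof (intro allI impI)
      fix X :: "real^2^2"
      assume "A * X = 0 \<and> A ** transpose X - transpose X ** A = 0 \<and>
        (\<forall>k < CARD(2). trace (transpose X ** mat_power A k) = 0)"
      then have "A$1$1 * X$1$1 = 0" "A$1$2 * X$1$2 = 0" "A$2$1 * X$2$1 = 0" "A$2$2 * X$2$2 = 0"
        and "X$1$1 + X$2$2 = 0"
        and "A$1$1 * X$2$1 + A$1$2 * X$2$2 = X$1$1 * A$1$2 + X$2$1 * A$2$2"
        and "A$2$1 * X$1$1 + A$2$2 * X$1$2 = X$1$2 * A$1$1 + X$2$2 * A$2$1"
        by (auto simp: entries)
      \<comment> \<open>If the diagonal entries of \<open>A\<close> differ, one of them is nonzero,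
        so the entrywise equations and \<open>X$1$1 + X$2$2 = 0\<close> kill the diagonal of
        \<open>X\<close>, and the commutation equations then kill the rest. If both off-diagonal
        entries of \<open>A\<close> are nonzero, those of \<open>X\<close> vanish first and the
        commutation equations kill its diagonal.\<close>
      with \<open>?R\<close> show "X = 0"
        by (auto simp: vec_eq_iff forall_2)
    qed
  next
    assume "nSMP A"
    show ?R
    proof (rule ccontr)
      assume "\<not> ?R"
      then have diag: "A$1$1 = A$2$2" and off: "A$1$2 = 0 \<or> A$2$1 = 0"
        by auto
      \<comment> \<open>The 1 sits at position (1,2) if \<open>A\<close> vanishes there, and
        otherwise at (2,1).\<close>
      define X :: "real^2^2" where
        "X = (\<chi> i j. if i \<noteq> j \<and> A $ i $ j = 0 \<and> (i = 1 \<or> A $ 1 $ 2 \<noteq> 0) then 1 else 0)"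
      have "A * X = 0 \<and> A ** transpose X - transpose X ** A = 0 \<and>
          (\<forall>k < CARD(2). trace (transpose X ** mat_power A k) = 0)"
        using diag off by (auto simp: entries X_def)
      with \<open>nSMP A\<close> have "X = 0"
        by (simp add: nSMP_def)
      with off show False
        by (auto simp: X_def vec_eq_iff forall_2 split: if_splits)
    qed
  qed
qed

text \<open>Both diagonal blocks have size one, so the block below them is a single off-diagonal
  entry; the permutation decides which one.\<close>

lemma reducible_pattern_2_iff:
  fixes P :: "sign^2^2"
  shows "reducible_pattern P \<longleftrightarrow> P $ 1 $ 2 = Zero \<or> P $ 2 $ 1 = Zero"
proof
  assume "reducible_pattern P"
  then obtain R \<pi> b where \<pi>: "\<pi> permutes (UNIV :: 2 set)"
    and R: "R = (\<chi> i j. P $ \<pi> i $ \<pi> j)"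
    and ne: "{..<b} \<noteq> {}" "{b..} \<noteq> {}"
    and zero: "\<forall>i\<in>{b..}. \<forall>j\<in>{..<b}. R $ i $ j = 0"
    unfolding reducible_pattern_def perm_similar_def block_upper_triangular_def by blast
  from ne obtain i j where "i \<in> {b..}" "j \<in> {..<b}"
    by blast
  then have "i \<noteq> j" "P $ \<pi> i $ \<pi> j = 0"
    using zero R by auto
  moreover from \<open>i \<noteq> j\<close> have "\<pi> i \<noteq> \<pi> j"
    using permutes_inj[OF \<pi>] by (simp add: inj_eq)
  ultimately show "P $ 1 $ 2 = Zero \<or> P $ 2 $ 1 = Zero"
    using exhaust_2[of "\<pi> i"] exhaust_2[of "\<pi> j"] by (auto simp: zero_sign_def)
next
  \<comment> \<open>Since 2 is 0 in this type, index 2 comes first and the cut \<open>b = 1\<close>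
    separates it from index 1. The entry required to vanish is therefore the one at (1,2) of the
    permuted pattern.\<close>
  have lt: "(2 :: 2) < 1"
    by (simp add: less_bit0_def bit0.Rep_numeral bit0.Rep_1)
  have blocks: "{..<1 :: 2} = {2}" "{1 :: 2..} = {1}"
    using lt exhaust_2 by (auto simp: set_eq_iff forall_2)
  have *: "reducible_pattern P"
    if "\<pi> permutes (UNIV :: 2 set)" "P $ \<pi> 1 $ \<pi> 2 = Zero" for \<pi>
    unfolding reducible_pattern_def perm_similar_def block_upper_triangular_def
    using that blocks
    by (intro exI[of _ "\<chi> i j. P $ \<pi> i $ \<pi> j"] conjI exI[of _ \<pi>] exI[of _ 1])
       (simp_all add: zero_sign_def)
  assume "P $ 1 $ 2 = Zero \<or> P $ 2 $ 1 = Zero"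
  then show "reducible_pattern P"
    using *[of id] *[of "Transposition.transpose 1 2"]
    by (auto simp: permutes_id permutes_swap_id)
qed

fun sign_value :: "sign \<Rightarrow> real" where
  "sign_value Pos = 1"
| "sign_value Neg = - 1"
| "sign_value Zero = 0"

lemma scaled_sign_value_in_qual_class:
  assumes "\<And>i j. 0 < r i j"
  shows "(\<chi> i j. r i j * sign_value (P $ i $ j)) \<in> qual_class P"
  using assms by (auto simp: qual_class_def)

lemma qual_class_entry_eq_0_iff:
  assumes "A \<in> qual_class P"
  shows "A $ i $ j = 0 \<longleftrightarrow> P $ i $ j = Zero"
  using assms by (cases "P $ i $ j") (force simp: qual_class_def)+

text \<open>The sign of a real entry determines its symbol. Part (b) uses the contrapositive:
  distinct diagonal symbols force distinct diagonal entries.\<close>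

lemma qual_class_sign_eq:
  assumes "A \<in> qual_class P" "A $ i $ j = A $ k $ l"
  shows "P $ i $ j = P $ k $ l"
proof -
  have "P $ i $ j = (if A $ i $ j > 0 then Pos else if A $ i $ j < 0 then Neg else Zero)" for i j
    using assms(1) by (cases "P $ i $ j") (force simp: qual_class_def)+
  with assms(2) show ?thesis
    by metis
qed

theorem theorem6p1:
  fixes P :: "sign^2^2"
  shows "(irreducible_pattern P \<longrightarrow> pattern_requires P nSMP)
    \<and> ((\<exists>R. pattern_equiv P R \<and> reducible_pattern R) \<and> P $ 1 $ 1 \<noteq> P $ 2 $ 2
         \<longrightarrow> pattern_requires P nSMP)
    \<and> (reducible_pattern P \<and> P $ 1 $ 1 = Zero \<and> P $ 2 $ 2 = Zero
         \<longrightarrow> \<not> pattern_allows P nSMP)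
    \<and> (reducible_pattern P \<and> P $ 1 $ 1 = P $ 2 $ 2 \<and> P $ 1 $ 1 \<noteq> Zero
         \<longrightarrow> pattern_allows P nSMP \<and> \<not> pattern_requires P nSMP)"
proof (intro conjI impI)
  assume "irreducible_pattern P"
  then show "pattern_requires P nSMP"
    by (simp add: pattern_requires_def nSMP_2_iff reducible_pattern_2_iff qual_class_entry_eq_0_iff)
next
  assume "(\<exists>R. pattern_equiv P R \<and> reducible_pattern R) \<and> P $ 1 $ 1 \<noteq> P $ 2 $ 2"
  then show "pattern_requires P nSMP"
    by (auto simp: pattern_requires_def nSMP_2_iff dest: qual_class_sign_eq)
next
  assume "reducible_pattern P \<and> P $ 1 $ 1 = Zero \<and> P $ 2 $ 2 = Zero"
  then show "\<not> pattern_allows P nSMP"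
    unfolding pattern_allows_def nSMP_2_iff reducible_pattern_2_iff
    by (metis qual_class_entry_eq_0_iff)
next
  assume P: "reducible_pattern P \<and> P $ 1 $ 1 = P $ 2 $ 2 \<and> P $ 1 $ 1 \<noteq> Zero"
  then have "sign_value (P $ 2 $ 2) \<noteq> 0"
    by (cases "P $ 2 $ 2") auto
  \<comment> \<open>Doubling the second row separates the diagonal entries, which become s and 2s
    with s nonzero.\<close>
  with P have "nSMP (\<chi> i j. (if i = 1 then 1 else 2) * sign_value (P $ i $ j))"
    by (simp add: nSMP_2_iff)
  then show "pattern_allows P nSMP"
    unfolding pattern_allows_def by (rule bexI) (rule scaled_sign_value_in_qual_class, simp)
next
  assume P: "reducible_pattern P \<and> P $ 1 $ 1 = P $ 2 $ 2 \<and> P $ 1 $ 1 \<noteq> Zero"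
  \<comment> \<open>With all magnitudes 1, equal diagonal symbols give equal diagonal entries, and
    reducibility supplies an off-diagonal zero.\<close>
  then have "\<not> nSMP (\<chi> i j. 1 * sign_value (P $ i $ j))"
    by (auto simp: nSMP_2_iff reducible_pattern_2_iff)
  then show "\<not> pattern_requires P nSMP"
    unfolding pattern_requires_def using scaled_sign_value_in_qual_class[of "\<lambda>_ _. 1" P] by auto
qed

end
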